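(* Let $N\ge3$, let $\mathcal P^0\subset\mathbb R^{N-1}$ be a bounded polyhedron containing the true partworth $\mathbf v^*$, let $\mathcal B^0$ be its minimum enclosing ball with radius $r(\mathcal B^0)>0$, and let $\mathcal P^{k,i}$ be generated by the coordinate-wise polyhedral method (CPM) described in the context. Let $\epsilon>0$ and $$K:=\left\lceil\frac{2\,[\log\epsilon-\log (2r(\mathcal B^0))]}{\log(N-2)-\log(N-1)}\right\rceil .$$ Then at most $(N-1)K$ queries ($K$ major iterations of $N-1$ queries each; none if $K\le 0$) suffice to guarantee a maximum error at most $\epsilon$: the polyhedron $\mathcal P^{\max\{K,0\}}$ satisfies $\max_{\mathbf v\in\mathcal P^{\max\{K,0\}}}\|\mathbf v-\mathbf v^*\|_2\le\epsilon$, and likewise $\max_{\mathbf v\in\mathcal P^{k,i}}\|\mathbf v-\mathbf v^*\|_2\le\epsilon$ for all integers $k\ge\max\{K,0\}$ and $i\in\{1,\dots,N-1\}$.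
   Context: The recovery mapping is $R:\mathbb R^{N-1}\to\mathbb R^N$, $R\mathbf y=(\mathbf y,\,1-\mathbf e^\top\mathbf y)$, with $\mathbf e$ the all-ones vector. A decision maker has true utility $u^*(\mathbf x)=(R\mathbf v^* )^\top\mathbf x$ on $\mathbb R^N$ with unknown $\mathbf v^*\in\mathbb R^{N-1}$, and answers comparisons without error. The minimum enclosing ball (MEB) of a bounded set is the closed Euclidean ball of smallest radius containing it. CPM: start from $\mathcal P^0$. For $k=0,1,2,\dots$ (run without a stopping rule; each $k$ is one major iteration): (1) let $\mathcal B^k$ be the MEB of $\mathcal P^k$, with center $\mathbf c^k$ and radius $r(\mathcal B^k)$; (2) choose an arbitrary orthonormal basis $\boldsymbol\alpha^{k,1},\dots,\boldsymbol\alpha^{k,N-1}$ of $\mathbb R^{N-1}$ and put $\mathcal P^{k,0}=\mathcal P^k$; (3) for $i=1,\dots,N-1$: present a query $(\mathbf x^{A},\mathbf x^{B})\in\mathbb R^N\times\mathbb R^N$ with separating hyperplane $\{\mathbf v:(\boldsymbol\alpha^{k,i})^\top(\mathbf v-\mathbf c^k)=0\}$, namely such that for some $\gamma>0$, $x^A_N-x^B_N=-\gamma(\boldsymbol\alpha^{k,i})^\top\mathbf c^k$ and $x^A_j-x^B_j=(x^A_N-x^B_N)+\gamma\alpha^{k,i}_j$ for $j=1,\dots,N-1$ (so that $(R\mathbf v)^\top(\mathbf x^A-\mathbf x^B)=\gamma(\boldsymbol\alpha^{k,i})^\top(\mathbf v-\mathbf c^k)$ for all $\mathbf v$); set $\mu^{k,i}=-1$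 if $(R\mathbf v^* )^\top\mathbf x^A\ge(R\mathbf v^* )^\top\mathbf x^B$ and $\mu^{k,i}=1$ otherwise; update $$\mathcal P^{k,i}=\mathcal P^{k,i-1}\cap\{\mathbf v\in\mathbb R^{N-1}:\mu^{k,i}(R\mathbf v)^\top(\mathbf x^A-\mathbf x^B)\le 0\};$$ (4) set $\mathcal P^{k+1}=\mathcal P^{k,N-1}$. *)

theory Defs
  imports "HOL-Analysis.Analysis"
begin

text \<open>
  The space of partworths (of dimension \<open>N - 1\<close>) is \<open>real ^ 'n\<close> with \<open>CARD('n) = N - 1\<close>, and the
  space of alternatives (of dimension \<open>N\<close>) is \<open>real ^ 'n option\<close>: the coordinates \<open>Some j\<close> are the
  first \<open>N - 1\<close> ones and \<open>None\<close> is the \<open>N\<close>-th one.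
\<close>

definition recovery :: "real ^ 'n \<Rightarrow> real ^ 'n option" where
  "recovery y = (\<chi> i. case i of Some j \<Rightarrow> y $ j | None \<Rightarrow> 1 - (\<Sum>j\<in>UNIV. y $ j))"

definition utility :: "real ^ 'n \<Rightarrow> real ^ 'n option \<Rightarrow> real" where
  "utility v x = recovery v \<bullet> x"

text \<open>
  The centre and the radius below are meaningful for nonempty bounded sets in a Euclidean space, for
  which there is exactly one minimum enclosing ball.
\<close>

definition is_meb :: "'a::metric_space set \<Rightarrow> 'a \<Rightarrow> real \<Rightarrow> bool" where
  "is_meb S c r \<longleftrightarrow> 0 \<le> r \<and> S \<subseteq> cball c r \<and> (\<forall>c' r'. 0 \<le> r' \<longrightarrow> S \<subseteq> cball c' r' \<longrightarrow> r \<le> r')"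

definition meb_center :: "'a::metric_space set \<Rightarrow> 'a" where
  "meb_center S = (THE c. \<exists>r. is_meb S c r)"

definition meb_radius :: "'a::metric_space set \<Rightarrow> real" where
  "meb_radius S = (THE r. \<exists>c. is_meb S c r)"

definition orthonormal_basis :: "(nat \<Rightarrow> real ^ 'n) \<Rightarrow> bool" where
  "orthonormal_basis \<alpha> \<longleftrightarrow>
     (\<forall>i\<in>{1..CARD('n)}. \<forall>j\<in>{1..CARD('n)}. \<alpha> i \<bullet> \<alpha> j = (if i = j then 1 else 0)) \<and>
     span (\<alpha> ` {1..CARD('n)}) = UNIV"

definition separating_query ::
    "real ^ 'n \<Rightarrow> real ^ 'n \<Rightarrow> real ^ 'n option \<Rightarrow> real ^ 'n option \<Rightarrow> bool" where
  "separating_query a c xA xB \<longleftrightarrow>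
     (\<exists>\<gamma>>0. xA $ None - xB $ None = - \<gamma> * (a \<bullet> c) \<and>
        (\<forall>j. xA $ Some j - xB $ Some j = (xA $ None - xB $ None) + \<gamma> * a $ j))"

definition answer :: "real ^ 'n \<Rightarrow> real ^ 'n option \<Rightarrow> real ^ 'n option \<Rightarrow> real" where
  "answer vstar xA xB = (if utility vstar xA \<ge> utility vstar xB then - 1 else 1)"

text \<open>
  \<open>cpm_run vstar \<alpha> xA xB P Q\<close>: a run of the coordinate-wise polyhedral method for the true partworth
  \<open>vstar\<close>, starting from \<open>P 0\<close>. \<open>P k\<close> is the polyhedron at the start of major iteration \<open>k\<close> and
  \<open>Q k i\<close> the one after its \<open>i\<close>-th query \<open>(xA k i, xB k i)\<close>, with \<open>1 \<le> i \<le> CARD('n)\<close>. The orthonormal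
  bases \<open>\<alpha> k\<close> and the queries are otherwise unconstrained, so they may depend on earlier answers.
\<close>

definition cpm_run ::
    "real ^ 'n \<Rightarrow> (nat \<Rightarrow> nat \<Rightarrow> real ^ 'n) \<Rightarrow>
     (nat \<Rightarrow> nat \<Rightarrow> real ^ 'n option) \<Rightarrow> (nat \<Rightarrow> nat \<Rightarrow> real ^ 'n option) \<Rightarrow>
     (nat \<Rightarrow> (real ^ 'n) set) \<Rightarrow> (nat \<Rightarrow> nat \<Rightarrow> (real ^ 'n) set) \<Rightarrow> bool" where
  "cpm_run vstar \<alpha> xA xB P Q \<longleftrightarrow>
     (\<forall>k. orthonormal_basis (\<alpha> k) \<and>
          Q k 0 = P k \<and>
          (\<forall>i\<in>{1..CARD('n)}.
             separating_query (\<alpha> k i) (meb_center (P k)) (xA k i) (xB k i) \<and>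
             Q k i = Q k (i - 1) \<inter>
               {v. answer vstar (xA k i) (xB k i) * (recovery v \<bullet> (xA k i - xB k i)) \<le> 0}) \<and>
          P (Suc k) = Q k (CARD('n)))"

text \<open>The queries presented during the first \<open>k\<close> major iterations, with \<open>m\<close> queries in each of them.\<close>

definition queries_presented ::
    "nat \<Rightarrow> (nat \<Rightarrow> nat \<Rightarrow> 'x) \<Rightarrow> (nat \<Rightarrow> nat \<Rightarrow> 'x) \<Rightarrow> nat \<Rightarrow> ('x \<times> 'x) list" where
  "queries_presented m xA xB k =
     concat (map (\<lambda>l. map (\<lambda>i. (xA l i, xB l i)) [1..<Suc m]) [0..<k])"

definition has_max_error :: "real ^ 'n \<Rightarrow> (real ^ 'n) set \<Rightarrow> real \<Rightarrow> bool" where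
  "has_max_error vstar S m \<longleftrightarrow>
     (\<exists>v\<in>S. norm (v - vstar) = m) \<and> (\<forall>v\<in>S. norm (v - vstar) \<le> m)"

end

theory Submission
  imports Defs
begin

text \<open>
  The half-spaces chosen in one major iteration cut out an orthant at the centre \<open>c\<close> of the minimum
  enclosing ball. With \<open>n = N - 1\<close> and \<open>u\<close> the sum of the unit vectors spanning the orthant, every
  point \<open>w\<close> of the orthant satisfies \<open>u \<bullet> (w - c) \<ge> norm (w - c)\<close>, so the part of a ball of radius \<open>r\<close>
  around \<open>c\<close> that lies in the orthant is contained in the ball of radius \<open>r * sqrt ((n - 1) / n)\<close>
  around \<open>c + (r / n) *\<^sub>R u\<close>. Hence the radius of the minimum enclosing ball shrinks at least by the
  factor \<open>sqrt ((n - 1) / n)\<close>, and the error is at most the diameter of that ball.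
\<close>

section \<open>Minimum enclosing balls\<close>

text \<open>Compactness argument: the centres admissible for radii slightly above the infimum
  \<open>Inf T\<close> form a decreasing sequence of nonempty compact sets, and a point common to
  all of them is a centre for \<open>Inf T\<close> itself.\<close>

lemma is_meb_exists:
  fixes S :: "'a::heine_borel set"
  assumes "bounded S" "S \<noteq> {}"
  shows "\<exists>c r. is_meb S c r"
proof -
  define T where "T = {r. 0 \<le> r \<and> (\<exists>c. S \<subseteq> cball c r)}"
  \<comment> \<open>By symmetry of the distance, \<open>F n\<close> is the set of centres whose
    closed ball of radius \<open>Inf T + 1 / real (Suc n)\<close> contains \<open>S\<close>.\<close>
  define F where "F n = (\<Inter>x\<in>S. cball x (Inf T + 1 / real (Suc n)))" for n
  obtain a b where "S \<subseteq> cball a b"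
    using assms(1) bounded_subset_cball by blast
  moreover from this have "0 \<le> b"
    using assms(2) by (metis cball_empty not_le subset_empty)
  ultimately have "b \<in> T"
    by (auto simp: T_def)
  have bdd: "bdd_below T"
    by (auto simp: T_def bdd_below_def)
  have "compact (F n)" for n
    unfolding F_def using assms(2) by (intro compact_Inter) auto
  moreover have "F n \<noteq> {}" for n
  proof -
    have "Inf T < Inf T + 1 / real (Suc n)"
      by simp
    then obtain r where "r \<in> T" "r < Inf T + 1 / real (Suc n)"
      using \<open>b \<in> T\<close> bdd by (metis cInf_less_iff empty_iff)
    then obtain c where "S \<subseteq> cball c r"
      by (auto simp: T_def)
    then have "c \<in> F n"
      using \<open>r < _\<close> by (fastforce simp: F_def dist_commute)
    then show ?thesis
      by blast
  qed
  moreover have "F n \<subseteq> F m" if "m \<le> n" for m n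
  proof -
    have "1 / real (Suc n) \<le> 1 / real (Suc m)"
      using that by (simp add: field_simps)
    then show ?thesis
      by (fastforce simp: F_def)
  qed
  ultimately obtain c where c: "c \<in> \<Inter>(range F)"
    using compact_nest[of F] by blast
  have "dist x c \<le> Inf T" if "x \<in> S" for x
  proof (rule field_le_epsilon)
    fix e :: real
    assume "0 < e"
    then obtain n where "1 / real (Suc n) < e"
      using nat_approx_posE by blast
    moreover have "dist x c \<le> Inf T + 1 / real (Suc n)"
      using c that by (auto simp: F_def simp del: of_nat_Suc)
    ultimately show "dist x c \<le> Inf T + e"
      by linarith
  qed
  then have "S \<subseteq> cball c (Inf T)"
    by (auto simp: dist_commute)
  moreover have "0 \<le> Inf T"
    using \<open>b \<in> T\<close> by (intro cInf_greatest) (auto simp: T_def)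
  moreover have "Inf T \<le> r" if "0 \<le> r" "S \<subseteq> cball d r" for d r
    using that bdd by (intro cInf_lower) (auto simp: T_def)
  ultimately show ?thesis
    unfolding is_meb_def by blast
qed

lemma is_meb_unique_radius:
  "is_meb S c r \<Longrightarrow> is_meb S c' r' \<Longrightarrow> r = r'"
  unfolding is_meb_def by (meson order_antisym)

text \<open>By the parallelogram identity, the ball of radius \<open>s\<close> around the midpoint
  \<open>m\<close> of two optimal centres also encloses \<open>S\<close>. If the centres differed,
  \<open>s\<close> would be smaller than \<open>r\<close>.\<close>

lemma is_meb_unique_center:
  fixes S :: "'a::real_inner set"
  assumes "is_meb S c r" "is_meb S c' r" "S \<noteq> {}"
  shows "c = c'"
proof -
  define s where "s = sqrt (r\<^sup>2 - (norm (c - c'))\<^sup>2 / 4)"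
  define m where "m = (1 / 2) *\<^sub>R (c + c')"
  have mid: "(dist m x)\<^sup>2 \<le> r\<^sup>2 - (norm (c - c'))\<^sup>2 / 4" if "x \<in> S" for x
  proof -
    have "norm (c - x) \<le> r" "norm (c' - x) \<le> r"
      using assms(1,2) that by (auto simp: is_meb_def dist_norm)
    then have "(norm (c - x))\<^sup>2 \<le> r\<^sup>2" "(norm (c' - x))\<^sup>2 \<le> r\<^sup>2"
      by (simp_all add: power_mono)
    moreover have "(norm (m - x))\<^sup>2 =
        (norm (c - x))\<^sup>2 / 2 + (norm (c' - x))\<^sup>2 / 2 - (norm (c - c'))\<^sup>2 / 4"
      unfolding m_def power2_norm_eq_inner
      by (simp add: inner_diff inner_add inner_commute field_simps)
    ultimately show ?thesis
      by (simp add: dist_norm)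
  qed
  obtain x where "x \<in> S"
    using assms(3) by blast
  \<comment> \<open>A point of \<open>S\<close> makes the radicand of \<open>s\<close> nonnegative,
    so that \<open>s\<close> is a legitimate competing radius.\<close>
  from order_trans[OF zero_le_power2 mid[OF this]]
  have nonneg: "0 \<le> r\<^sup>2 - (norm (c - c'))\<^sup>2 / 4" .
  have "S \<subseteq> cball m s"
    using mid by (auto simp: s_def real_le_rsqrt)
  then have "r \<le> s"
    using assms(1) nonneg by (simp add: is_meb_def s_def)
  moreover have "0 \<le> r"
    using assms(1) by (simp add: is_meb_def)
  ultimately have "r\<^sup>2 \<le> s\<^sup>2"
    by (simp add: power_mono)
  then show ?thesis
    using nonneg by (simp add: s_def)
qed

text \<open>Existence and uniqueness together let both definite descriptions denote; from here on
  only \<open>is_meb\<close> is needed.\<close>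

lemma is_meb_center_radius:
  fixes S :: "'a::euclidean_space set"
  assumes "bounded S" "S \<noteq> {}"
  shows "is_meb S (meb_center S) (meb_radius S)"
proof -
  obtain c r where cr: "is_meb S c r"
    using is_meb_exists[OF assms] by blast
  have "meb_center S = c"
    unfolding meb_center_def
    using cr assms(2) is_meb_unique_center is_meb_unique_radius by (blast intro: the_equality)
  moreover have "meb_radius S = r"
    unfolding meb_radius_def
    using cr is_meb_unique_radius by (blast intro: the_equality)
  ultimately show ?thesis
    using cr by simp
qed

lemma norm_diff_le_meb_radius:
  fixes S :: "'a::euclidean_space set"
  assumes "bounded S" "v \<in> S" "w \<in> S"
  shows "norm (v - w) \<le> 2 * meb_radius S"
proof -
  have "S \<subseteq> cball (meb_center S) (meb_radius S)"
    using is_meb_center_radius[of S] assms by (auto simp: is_meb_def)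
  then have "dist (meb_center S) v \<le> meb_radius S" "dist (meb_center S) w \<le> meb_radius S"
    using assms by auto
  then show ?thesis
    using dist_triangle3[of v w "meb_center S"] by (simp add: dist_norm)
qed

section \<open>A ball cut by an orthant\<close>

text \<open>The residual \<open>z\<close> is orthogonal to each \<alpha> i, hence to their span,
  which is the whole space, hence to itself.\<close>

lemma orthonormal_family_expand:
  fixes \<alpha> :: "'i \<Rightarrow> 'a::real_inner"
  assumes "finite I"
    and "\<And>i j. i \<in> I \<Longrightarrow> j \<in> I \<Longrightarrow> \<alpha> i \<bullet> \<alpha> j = (if i = j then 1 else 0)"
    and "span (\<alpha> ` I) = UNIV"
  shows "w = (\<Sum>i\<in>I. (\<alpha> i \<bullet> w) *\<^sub>R \<alpha> i)"
proof -
  define z where "z = w - (\<Sum>i\<in>I. (\<alpha> i \<bullet> w) *\<^sub>R \<alpha> i)"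
  have "orthogonal x z" if "x \<in> \<alpha> ` I" for x
  proof -
    from that obtain j where j: "j \<in> I" "x = \<alpha> j"
      by blast
    have "(\<Sum>i\<in>I. (\<alpha> i \<bullet> w) * (\<alpha> i \<bullet> \<alpha> j)) = (\<Sum>i\<in>I. if i = j then \<alpha> i \<bullet> w else 0)"
      using assms(2) j by (intro sum.cong) auto
    then show ?thesis
      using assms(1) j
      by (simp add: orthogonal_def z_def inner_diff_right inner_sum_right
          inner_commute[of "\<alpha> j" "\<alpha> _"] inner_commute[of w])
  qed
  then have "orthogonal z z"
    using orthogonal_to_span[of z "\<alpha> ` I" z] assms(3) orthogonal_commute by blast
  then show ?thesis
    by (simp add: orthogonal_def z_def)
qed

lemma orthonormal_family_norm_square:
  fixes \<alpha> :: "'i \<Rightarrow> 'a::real_inner"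
  assumes "finite I"
    and "\<And>i j. i \<in> I \<Longrightarrow> j \<in> I \<Longrightarrow> \<alpha> i \<bullet> \<alpha> j = (if i = j then 1 else 0)"
  shows "(norm (\<Sum>i\<in>I. a i *\<^sub>R \<alpha> i))\<^sup>2 = (\<Sum>i\<in>I. (a i)\<^sup>2)"
proof -
  have "pairwise (\<lambda>i j. orthogonal (a i *\<^sub>R \<alpha> i) (a j *\<^sub>R \<alpha> j)) I"
    using assms(2) by (simp add: pairwise_def orthogonal_def)
  then have "(norm (\<Sum>i\<in>I. a i *\<^sub>R \<alpha> i))\<^sup>2 = (\<Sum>i\<in>I. (norm (a i *\<^sub>R \<alpha> i))\<^sup>2)"
    using assms(1) by (rule norm_sum_Pythagorean[rotated])
  also have "\<dots> = (\<Sum>i\<in>I. (a i)\<^sup>2)"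
    using assms(2) by (intro sum.cong) (simp_all add: norm_eq_sqrt_inner power_mult_distrib)
  finally show ?thesis .
qed

lemma cball_inter_orthant_subset_cball:
  fixes \<alpha> :: "'i \<Rightarrow> 'a::real_inner" and c :: 'a
  assumes I: "finite I" "card I \<ge> 2"
    and orth: "\<And>i j. i \<in> I \<Longrightarrow> j \<in> I \<Longrightarrow> \<alpha> i \<bullet> \<alpha> j = (if i = j then 1 else 0)"
    and span: "span (\<alpha> ` I) = UNIV"
    and sign: "\<And>i. i \<in> I \<Longrightarrow> \<bar>\<mu> i\<bar> = 1"
    and "0 \<le> r"
  shows "cball c r \<inter> {v. \<forall>i\<in>I. \<mu> i * (\<alpha> i \<bullet> (v - c)) \<le> 0}
    \<subseteq> cball (c - (r / card I) *\<^sub>R (\<Sum>i\<in>I. \<mu> i *\<^sub>R \<alpha> i)) (r * sqrt ((card I - 1) / card I))"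
proof clarify
  fix v
  assume "v \<in> cball c r" and v: "\<forall>i\<in>I. \<mu> i * (\<alpha> i \<bullet> (v - c)) \<le> 0"
  \<comment> \<open>The sign \<open>\<mu> i\<close> marks the side that is cut off, so
    \<open>u\<close> points away from the kept orthant and the new centre is \<open>c\<close> minus
    a multiple of \<open>u\<close>. Writing \<open>r = n * t\<close> keeps the quadratic below free
    of fractions.\<close>
  define n t w u where "n = real (card I)" and "t = r / n" and "w = v - c"
    and "u = (\<Sum>i\<in>I. \<mu> i *\<^sub>R \<alpha> i)"
  define y where "y i = - (\<mu> i * (\<alpha> i \<bullet> w))" for i
  have n: "2 \<le> n"
    using I(2) by (simp add: n_def)
  then have t: "0 \<le> t" "r = n * t"
    using \<open>0 \<le> r\<close> by (simp_all add: t_def)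
  have w: "norm w \<le> n * t"
    using \<open>v \<in> cball c r\<close> t(2) by (simp add: w_def dist_norm norm_minus_commute)
  have mu2: "(\<mu> i)\<^sup>2 = 1" if "i \<in> I" for i
    using sign[OF that] by (simp add: abs_square_eq_1)
  \<comment> \<open>Up to sign the \<open>y i\<close> are the coordinates of \<open>w\<close>, and
    they are nonnegative on the orthant; so the norm of \<open>w\<close> is at most their sum, which
    is \<open>- (w \<bullet> u)\<close>.\<close>
  have "(norm w)\<^sup>2 = (\<Sum>i\<in>I. (\<alpha> i \<bullet> w)\<^sup>2)"
    using orthonormal_family_norm_square[OF I(1) orth, of "\<lambda>i. \<alpha> i \<bullet> w"]
    by (simp flip: orthonormal_family_expand[OF I(1) orth span])
  also have "\<dots> = (\<Sum>i\<in>I. (y i)\<^sup>2)"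
    using mu2 by (intro sum.cong) (simp_all add: y_def power_mult_distrib)
  finally have "norm w = L2_set y I"
    by (simp add: L2_set_def real_sqrt_unique)
  also have "\<dots> \<le> sum y I"
    using v by (intro L2_set_le_sum) (simp add: y_def w_def)
  also have "\<dots> = - (w \<bullet> u)"
    by (simp add: y_def u_def inner_sum_right inner_commute sum_negf)
  finally have wu: "w \<bullet> u \<le> - norm w"
    by simp
  have u2: "(norm u)\<^sup>2 = n"
    using orthonormal_family_norm_square[OF I(1) orth, of \<mu>] mu2 by (simp add: u_def n_def)
  have "(norm (w + t *\<^sub>R u))\<^sup>2 = (norm w)\<^sup>2 + 2 * t * (w \<bullet> u) + t\<^sup>2 * n"
    unfolding u2[symmetric] power2_norm_eq_inner
    by (simp add: inner_add inner_commute power2_eq_square)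
  also have "\<dots> \<le> (norm w)\<^sup>2 - 2 * t * norm w + t\<^sup>2 * n"
    using mult_left_mono[OF wu t(1)] by simp
  \<comment> \<open>A convex quadratic in \<open>norm w\<close>, hence maximal at \<open>norm w = 0\<close> or at \<open>norm w = n * t\<close>;
    since \<open>n \<ge> 2\<close>, the latter wins.\<close>
  also have "\<dots> \<le> n * (n - 1) * t\<^sup>2"
  proof -
    have "0 \<le> (n * t - norm w) * (norm w + (n - 2) * t)"
      using w n t(1) by (intro mult_nonneg_nonneg) auto
    then show ?thesis
      by (simp add: algebra_simps power2_eq_square)
  qed
  also have "\<dots> = (r * sqrt ((n - 1) / n))\<^sup>2"
    using n by (simp add: t(2) power_mult_distrib) (simp add: power2_eq_square)
  finally have "norm (w + t *\<^sub>R u) \<le> r * sqrt ((n - 1) / n)"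
    by (rule power2_le_imp_le) (use \<open>0 \<le> r\<close> n in simp)
  then show "v \<in> cball (c - (r / card I) *\<^sub>R (\<Sum>i\<in>I. \<mu> i *\<^sub>R \<alpha> i))
      (r * sqrt ((card I - 1) / card I))"
    using I(2)
    by (simp add: dist_norm norm_minus_commute w_def t_def u_def n_def algebra_simps of_nat_diff)
qed

section \<open>Runs of the method\<close>

text \<open>The last coordinate difference is added to all the others, and the coordinates of
  \<open>recovery v\<close> sum to 1; hence it contributes exactly once, as the constant term
  \<open>- \<gamma> * (a \<bullet> c)\<close>.\<close>

lemma recovery_inner_separating_query:
  assumes "separating_query a c xA xB"
  shows "\<exists>\<gamma>>0. \<forall>v. recovery v \<bullet> (xA - xB) = \<gamma> * (a \<bullet> (v - c))"
proof -
  obtain \<gamma> where "\<gamma> > 0" and N: "xA $ None - xB $ None = - \<gamma> * (a \<bullet> c)"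
    and S: "\<And>j. xA $ Some j - xB $ Some j = (xA $ None - xB $ None) + \<gamma> * a $ j"
    using assms by (auto simp: separating_query_def)
  have "recovery v \<bullet> (xA - xB) = \<gamma> * (a \<bullet> (v - c))" for v
  proof -
    have "recovery v \<bullet> (xA - xB) = (1 - (\<Sum>j\<in>UNIV. v $ j)) * (xA $ None - xB $ None)
        + (\<Sum>j\<in>UNIV. v $ j * (xA $ Some j - xB $ Some j))"
      by (simp add: inner_vec_def recovery_def UNIV_option_conv sum.reindex)
    also have "\<dots> = (xA $ None - xB $ None) + \<gamma> * (\<Sum>j\<in>UNIV. a $ j * v $ j)"
      unfolding S
      by (simp add: algebra_simps sum.distrib sum_distrib_left sum_subtractf)
    also have "\<dots> = \<gamma> * (a \<bullet> (v - c))"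
      by (simp add: N inner_vec_def right_diff_distrib sum_subtractf)
    finally show ?thesis .
  qed
  then show ?thesis
    using \<open>\<gamma> > 0\<close> by blast
qed

text \<open>Answers are free of error, so no cut ever removes the true partworth; in a tie the
  product is 0.\<close>

lemma answer_consistent:
  "answer vstar xA xB * (recovery vstar \<bullet> (xA - xB)) \<le> 0"
  by (simp add: answer_def utility_def inner_diff_right)

lemma abs_answer: "\<bar>answer vstar xA xB\<bar> = 1"
  by (simp add: answer_def)

context
  fixes vstar :: "real ^ 'n" and \<alpha> xA xB P Q
  assumes run: "cpm_run vstar \<alpha> xA xB P Q"
begin

text \<open>Unrolls the recursion into simultaneous cuts of \<open>P k\<close>, the form from which
  inclusion in \<open>P k\<close>, compactness and the orthant are read off.\<close>

lemma cpm_Q_eq: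
  assumes "i \<le> CARD('n)"
  shows "Q k i = P k \<inter>
    {v. \<forall>j\<in>{1..i}. answer vstar (xA k j) (xB k j) * (recovery v \<bullet> (xA k j - xB k j)) \<le> 0}"
  using assms
proof (induction i)
  case 0
  then show ?case
    using run by (simp add: cpm_run_def)
next
  case (Suc i)
  then have "Q k (Suc i) = Q k i \<inter> {v. answer vstar (xA k (Suc i)) (xB k (Suc i)) *
      (recovery v \<bullet> (xA k (Suc i) - xB k (Suc i))) \<le> 0}"
    using run by (simp add: cpm_run_def)
  then show ?case
    using Suc by (auto simp: atLeastAtMostSuc_conv)
qed

lemma cpm_P_Suc: "P (Suc k) = Q k CARD('n)"
  using run by (simp add: cpm_run_def)

lemma closed_cpm_cut:
  fixes x y :: "real ^ 'n option"
  shows "closed {v. answer vstar x y * (recovery v \<bullet> (x - y)) \<le> 0}"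
  unfolding inner_vec_def recovery_def
  by (auto simp: UNIV_option_conv sum.reindex intro!: closed_Collect_le continuous_intros)

text \<open>Compactness is carried along, not just boundedness, because the maximum error has to be
  attained.\<close>

lemma cpm_Q_compact:
  assumes "compact (P k)" "i \<le> CARD('n)"
  shows "compact (Q k i)"
proof -
  have "closed (\<Inter>j\<in>{1..i}. {v. answer vstar (xA k j) (xB k j) *
      (recovery v \<bullet> (xA k j - xB k j)) \<le> 0})"
    using closed_cpm_cut by blast
  then have "compact (P k \<inter> (\<Inter>j\<in>{1..i}. {v. answer vstar (xA k j) (xB k j) *
      (recovery v \<bullet> (xA k j - xB k j)) \<le> 0}))"
    using assms(1) by (rule compact_Int_closed[rotated])
  then show ?thesis
    unfolding cpm_Q_eq[OF assms(2)] by (simp add: INTER_eq)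
qed

lemma cpm_P_compact: "compact (P 0) \<Longrightarrow> compact (P k)"
  by (induction k) (simp_all add: cpm_P_Suc cpm_Q_compact)

lemma vstar_in_cpm_Q: "vstar \<in> P k \<Longrightarrow> i \<le> CARD('n) \<Longrightarrow> vstar \<in> Q k i"
  by (simp add: cpm_Q_eq answer_consistent)

lemma vstar_in_cpm_P: "vstar \<in> P 0 \<Longrightarrow> vstar \<in> P k"
  by (induction k) (simp_all add: cpm_P_Suc vstar_in_cpm_Q)

text \<open>All hyperplanes of one major iteration pass through the centre of the same ball and have
  orthonormal normals, so \<open>cball_inter_orthant_subset_cball\<close> applies to what is left of
  that ball.\<close>

lemma meb_radius_cpm_Suc:
  assumes "bounded (P k)" "vstar \<in> P k" "CARD('n) \<ge> 2"
  shows "meb_radius (P (Suc k)) \<le> meb_radius (P k) * sqrt ((CARD('n) - 1) / CARD('n))"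
proof -
  define c r where "c = meb_center (P k)" and "r = meb_radius (P k)"
  define \<mu> where "\<mu> i = answer vstar (xA k i) (xB k i)" for i
  have meb: "is_meb (P k) c r"
    using is_meb_center_radius assms unfolding c_def r_def by blast
  have basis: "orthonormal_basis (\<alpha> k)"
    using run by (simp add: cpm_run_def)
  have "\<mu> i * (\<alpha> k i \<bullet> (v - c)) \<le> 0" if "v \<in> P (Suc k)" "i \<in> {1..CARD('n)}" for v i
  proof -
    have "separating_query (\<alpha> k i) c (xA k i) (xB k i)"
      using run that(2) by (simp add: cpm_run_def c_def)
    from recovery_inner_separating_query[OF this]
    obtain \<gamma> where "\<gamma> > 0" "recovery v \<bullet> (xA k i - xB k i) = \<gamma> * (\<alpha> k i \<bullet> (v - c))"
      by blast
    moreover have "\<mu> i * (recovery v \<bullet> (xA k i - xB k i)) \<le> 0"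
      using that unfolding cpm_P_Suc cpm_Q_eq[OF order_refl] \<mu>_def by blast
    ultimately have "\<gamma> * (\<mu> i * (\<alpha> k i \<bullet> (v - c))) \<le> 0"
      by (simp add: mult.left_commute)
    then show ?thesis
      using \<open>\<gamma> > 0\<close> by (simp add: mult_le_0_iff)
  qed
  moreover have "P (Suc k) \<subseteq> cball c r"
    using meb unfolding cpm_P_Suc cpm_Q_eq[OF order_refl] is_meb_def by blast
  ultimately have "P (Suc k) \<subseteq>
      cball c r \<inter> {v. \<forall>i\<in>{1..CARD('n)}. \<mu> i * (\<alpha> k i \<bullet> (v - c)) \<le> 0}"
    by blast
  also have "\<dots> \<subseteq> cball (c - (r / CARD('n)) *\<^sub>R (\<Sum>i\<in>{1..CARD('n)}. \<mu> i *\<^sub>R \<alpha> k i))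
      (r * sqrt ((CARD('n) - 1) / CARD('n)))"
    using cball_inter_orthant_subset_cball[of "{1..CARD('n)}" "\<alpha> k" \<mu> r c] basis meb assms(3)
    by (simp add: orthonormal_basis_def is_meb_def \<mu>_def abs_answer)
  finally have sub: "P (Suc k) \<subseteq> \<dots>" .
  then have "bounded (P (Suc k))"
    using bounded_cball bounded_subset by blast
  moreover have "P (Suc k) \<noteq> {}"
    using vstar_in_cpm_Q[OF assms(2) order_refl] cpm_P_Suc by auto
  ultimately have "is_meb (P (Suc k)) (meb_center (P (Suc k))) (meb_radius (P (Suc k)))"
    by (rule is_meb_center_radius)
  \<comment> \<open>The ball in \<open>sub\<close> competes in the minimality clause of
    \<open>is_meb\<close>, so the new centre need not be known.\<close>
  then show ?thesis
    using sub meb unfolding is_meb_def r_def by (simp add: r_def)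
qed

lemma meb_radius_cpm:
  assumes "compact (P 0)" "vstar \<in> P 0" "CARD('n) \<ge> 2"
  shows "meb_radius (P k) \<le> meb_radius (P 0) * sqrt ((CARD('n) - 1) / CARD('n)) ^ k"
proof (induction k)
  case (Suc k)
  have "meb_radius (P (Suc k)) \<le> meb_radius (P k) * sqrt ((CARD('n) - 1) / CARD('n))"
    using assms cpm_P_compact vstar_in_cpm_P compact_imp_bounded meb_radius_cpm_Suc by blast
  also have "\<dots> \<le> meb_radius (P 0) * sqrt ((CARD('n) - 1) / CARD('n)) ^ k
      * sqrt ((CARD('n) - 1) / CARD('n))"
    using Suc by (intro mult_right_mono) auto
  finally show ?case
    by (simp add: mult_ac)
qed simp

end

section \<open>From the contraction of the radius to the number of queries\<close>

lemma has_max_error_exists: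
  assumes "compact S" "S \<noteq> {}" "\<And>v. v \<in> S \<Longrightarrow> norm (v - vstar) \<le> b"
  shows "\<exists>m\<le>b. has_max_error vstar S m"
proof -
  have "continuous_on S (\<lambda>v. norm (v - vstar))"
    by (intro continuous_intros)
  from continuous_attains_sup[OF assms(1,2) this]
  show ?thesis
    using assms(3) by (auto simp: has_max_error_def)
qed

lemma length_queries_presented: "length (queries_presented m xA xB k) = k * m"
  by (simp add: queries_presented_def length_concat comp_def sum_list_triv)

text \<open>Since \<open>ln q\<close> is negative, clearing the denominator reverses the inequality;
  the factor 2 compensates for \<open>ln (sqrt q) = ln q / 2\<close>.\<close>

lemma geometric_le_of_log_le:
  fixes q R \<epsilon> :: real
  assumes "0 < q" "q < 1" "0 < R" "0 < \<epsilon>" and k: "2 * (ln \<epsilon> - ln R) / ln q \<le> real k"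
  shows "R * sqrt q ^ k \<le> \<epsilon>"
proof -
  have "ln q < 0"
    using assms by simp
  with k have "real k * ln q \<le> 2 * (ln \<epsilon> - ln R)"
    by (simp add: neg_divide_le_eq)
  then have "ln (R * sqrt q ^ k) \<le> ln \<epsilon>"
    using assms(1,3) by (simp add: ln_mult ln_realpow ln_sqrt)
  then show ?thesis
    using assms by simp
qed

theorem corollary3p1:
  fixes N :: nat
    and vstar :: "real ^ 'n"
    and \<alpha> :: "nat \<Rightarrow> nat \<Rightarrow> real ^ 'n"
    and xA xB :: "nat \<Rightarrow> nat \<Rightarrow> real ^ 'n option"
    and P :: "nat \<Rightarrow> (real ^ 'n) set"
    and Q :: "nat \<Rightarrow> nat \<Rightarrow> (real ^ 'n) set"
    and \<epsilon> :: real
    and K :: int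
  assumes "N \<ge> 3" and "CARD('n) = N - 1"
    and "polyhedron (P 0)" and "bounded (P 0)" and "vstar \<in> P 0"
    and "meb_radius (P 0) > 0"
    and "cpm_run vstar \<alpha> xA xB P Q"
    and "\<epsilon> > 0"
    and "K = \<lceil>2 * (ln \<epsilon> - ln (2 * meb_radius (P 0))) / (ln (real N - 2) - ln (real N - 1))\<rceil>"
  shows "int (length (queries_presented (N - 1) xA xB (nat (max K 0)))) = (int N - 1) * max K 0
    \<and> (\<exists>m\<le>\<epsilon>. has_max_error vstar (P (nat (max K 0))) m)
    \<and> (\<forall>k i. int k \<ge> max K 0 \<longrightarrow> i \<in> {1..N - 1} \<longrightarrow> (\<exists>m\<le>\<epsilon>. has_max_error vstar (Q k i) m))"
proof -
  \<comment> \<open>This is \<open>(N - 2) / (N - 1)\<close>, the factor by which the bound on the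
    squared radius shrinks in each major iteration; its logarithm is the denominator in
    \<open>K\<close>.\<close>
  define \<rho> where "\<rho> = (real CARD('n) - 1) / CARD('n)"
  have n: "CARD('n) \<ge> 2" and N: "real N = real CARD('n) + 1"
    using assms(1,2) by simp_all
  have cmp: "compact (P 0)"
    using assms(3,4) polyhedron_imp_closed compact_eq_bounded_closed by blast
  have "ln (real N - 2) - ln (real N - 1) = ln \<rho>"
    using n by (simp add: \<rho>_def N ln_div)
  then have K: "K = \<lceil>2 * (ln \<epsilon> - ln (2 * meb_radius (P 0))) / ln \<rho>\<rceil>"
    using assms(9) by simp
  have err: "norm (v - vstar) \<le> \<epsilon>" if "int k \<ge> max K 0" "v \<in> P k" for k v
  proof -
    have "2 * (ln \<epsilon> - ln (2 * meb_radius (P 0))) / ln \<rho> \<le> real k"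
      using that(1) le_of_int_ceiling[of "2 * (ln \<epsilon> - ln (2 * meb_radius (P 0))) / ln \<rho>"]
      unfolding K by linarith
    then have "2 * meb_radius (P 0) * sqrt \<rho> ^ k \<le> \<epsilon>"
      using n assms(6,8) by (intro geometric_le_of_log_le) (simp_all add: \<rho>_def)
    moreover have "meb_radius (P k) \<le> meb_radius (P 0) * sqrt \<rho> ^ k"
      using meb_radius_cpm[OF assms(7) cmp assms(5) n, of k] n by (simp add: \<rho>_def of_nat_diff)
    \<comment> \<open>\<open>vstar\<close> lies in \<open>P k\<close> too, so the error is a
      distance within one enclosing ball; hence the \<open>2 * meb_radius (P 0)\<close> in
      \<open>K\<close>.\<close>
    moreover have "norm (v - vstar) \<le> 2 * meb_radius (P k)"
      using that(2) cpm_P_compact[OF assms(7) cmp] vstar_in_cpm_P[OF assms(7,5)]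
      by (intro norm_diff_le_meb_radius compact_imp_bounded)
    ultimately show ?thesis
      by linarith
  qed
  have "int (length (queries_presented (N - 1) xA xB (nat (max K 0)))) = (int N - 1) * max K 0"
    using assms(1) by (simp add: length_queries_presented of_nat_diff)
  moreover have "\<exists>m\<le>\<epsilon>. has_max_error vstar (P (nat (max K 0))) m"
  proof (rule has_max_error_exists)
    show "compact (P (nat (max K 0)))"
      using cpm_P_compact[OF assms(7) cmp] .
    show "P (nat (max K 0)) \<noteq> {}"
      using vstar_in_cpm_P[OF assms(7,5)] by blast
    show "norm (v - vstar) \<le> \<epsilon>" if "v \<in> P (nat (max K 0))" for v
      using that by (intro err) simp_all
  qed
  moreover have "\<exists>m\<le>\<epsilon>. has_max_error vstar (Q k i) m" if "int k \<ge> max K 0" "i \<in> {1..N - 1}" for k i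
  proof (rule has_max_error_exists)
    have i: "i \<le> CARD('n)"
      using that(2) assms(2) by simp
    show "compact (Q k i)"
      using cpm_Q_compact[OF assms(7) cpm_P_compact[OF assms(7) cmp] i] .
    show "Q k i \<noteq> {}"
      using vstar_in_cpm_Q[OF assms(7) vstar_in_cpm_P[OF assms(7,5)] i] by blast
    \<comment> \<open>Cuts only shrink \<open>P k\<close>, so the bound at the start of the
      iteration persists after each query.\<close>
    show "norm (v - vstar) \<le> \<epsilon>" if "v \<in> Q k i" for v
      using that err[OF \<open>int k \<ge> max K 0\<close>] cpm_Q_eq[OF assms(7) i] by blast
  qed
  ultimately show ?thesis
    by blast
qed

end
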